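(* Let $\lambda=p/q>2$ with $p,q$ positive integers and $\gcd(p,q)=1$. Let $$A_{p,q}=\{n\in\mathbb{Z}:|n|<q\}\cup\{n\in\mathbb{Z}:|n-p|<q\}\cup\{n\in\mathbb{Z}:|n+p|<q\}.$$ Then $$\mathcal{T}_{\mathbb{R}}(\Omega_{p/q})=\frac1q\,\mathcal{T}_{\mathbb{Z}}(A_{p,q}).$$
   Context: For $\lambda\ge 0$ let $\Omega_\lambda=(-1,1)\cup(\lambda-1,\lambda+1)\cup(-\lambda-1,-\lambda+1)\subset\mathbb{R}$. A function $f:\mathbb{R}\to\mathbb{C}$ is positive definite if $\sum_{j,k=1}^m z_j\overline{z_k}f(x_j-x_k)\ge 0$ for all finite choices of $x_1,\dots,x_m\in\mathbb{R}$ and $z_1,\dots,z_m\in\mathbb{C}$. For an open bounded set $\Omega\subset\mathbb{R}$ with $\Omega=-\Omega$ and $0\in\Omega$, the Turán constant is $$\mathcal{T}_{\mathbb{R}}(\Omega)=\sup\left\{\int_{\mathbb{R}}f(x)\,dx: f\in C(\mathbb{R}),\ f \text{ positive definite},\ f(0)=1,\ \operatorname{supp} f\subset\Omega\right\},$$ where $\operatorname{supp} f$ is the closed support of $f$ (the integrals in question are automatically real). A complex sequence $(c_n)_{n\in\mathbb{Z}}$ is positive definite if $\sum_{j,k=1}^r z_j\overline{z_k}c_{m_j-m_k}\ge0$ for every finite set $\{m_1,\dots,m_r\}\subset\mathbb{Z}$ and all $z_1,\dots,z_r\in\mathbb{C}$. For a finite set $A\subset\mathbb{Z}$ with $A=-A$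 and $0\in A$, the discrete Turán constant is $$\mathcal{T}_{\mathbb{Z}}(A)=\sup\left\{\sum_{n\in A}c_n:(c_n)_{n\in\mathbb{Z}}\text{ positive definite},\ c_0=1,\ c_n=0\text{ for }n\notin A\right\}$$ (the sums in question are automatically real). *)

theory Defs
  imports "HOL-Analysis.Analysis"
begin

definition pos_def_fun :: "(real \<Rightarrow> complex) \<Rightarrow> bool" where
  "pos_def_fun f \<longleftrightarrow>
     (\<forall>(m::nat) (x::nat \<Rightarrow> real) (z::nat \<Rightarrow> complex).
        (\<Sum>j=1..m. \<Sum>k=1..m. z j * cnj (z k) * f (x j - x k)) \<in> \<real>\<^sub>\<ge>\<^sub>0)"

text \<open>The finite set \<open>S\<close> indexes its own elements, so the weights are a function on \<open>S\<close>.\<close>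

definition pos_def_seq :: "(int \<Rightarrow> complex) \<Rightarrow> bool" where
  "pos_def_seq c \<longleftrightarrow>
     (\<forall>S (z::int \<Rightarrow> complex). finite S \<longrightarrow>
        (\<Sum>m\<in>S. \<Sum>n\<in>S. z m * cnj (z n) * c (m - n)) \<in> \<real>\<^sub>\<ge>\<^sub>0)"

definition turan_fun_class :: "real set \<Rightarrow> (real \<Rightarrow> complex) set" where
  "turan_fun_class \<Omega> =
     {f. continuous_on UNIV f \<and> pos_def_fun f \<and> f 0 = 1 \<and> closure {x. f x \<noteq> 0} \<subseteq> \<Omega>}"

definition turan_seq_class :: "int set \<Rightarrow> (int \<Rightarrow> complex) set" where
  "turan_seq_class A = {c. pos_def_seq c \<and> c 0 = 1 \<and> (\<forall>n. n \<notin> A \<longrightarrow> c n = 0)}"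

text \<open>
  The real part only serves to obtain a real-valued supremum: the integrals and sums are real,
  and the suprema are over nonempty sets that are bounded above (lemmas below).
\<close>

definition turan_const_real :: "real set \<Rightarrow> real" where
  "turan_const_real \<Omega> = (SUP f\<in>turan_fun_class \<Omega>. Re (\<integral>x. f x \<partial>lborel))"

definition turan_const_int :: "int set \<Rightarrow> real" where
  "turan_const_int A = (SUP c\<in>turan_seq_class A. Re (\<Sum>n\<in>A. c n))"

definition Omega_set :: "real \<Rightarrow> real set" where
  "Omega_set lam = {-1<..<1} \<union> {lam - 1<..<lam + 1} \<union> {-lam - 1<..<-lam + 1}"

definition A_set :: "nat \<Rightarrow> nat \<Rightarrow> int set" where
  "A_set p q = {n. \<bar>n\<bar> < int q} \<union> {n. \<bar>n - int p\<bar> < int q} \<union> {n. \<bar>n + int p\<bar> < int q}"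


lemma two_point_pos_def:
  fixes F G :: complex
  assumes H: "\<And>a b::complex. a * cnj a + b * cnj b + a * cnj b * F + b * cnj a * G \<in> \<real>\<^sub>\<ge>\<^sub>0"
  shows "G = cnj F" and "cmod F \<le> 1"
proof -
  have "Im F + Im G = 0"
    using H[of 1 1] by (simp add: complex_nonneg_Reals_iff)
  moreover have "Re G - Re F = 0"
    using H[of 1 \<i>] by (simp add: complex_nonneg_Reals_iff)
  ultimately show G: "G = cnj F"
    by (simp add: complex_eq_iff)
  have "0 \<le> 1 - (cmod F)\<^sup>2"
    using H[of "- cnj F" 1] unfolding G cmod_power2
    by (simp add: complex_nonneg_Reals_iff power2_eq_square)
  then show "cmod F \<le> 1"
    using power2_le_imp_le[of "cmod F" 1] by simp
qed

lemma pos_def_fun_bounds: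
  assumes "pos_def_fun f" "f 0 = 1"
  shows "f (- x) = cnj (f x)" and "cmod (f x) \<le> 1"
proof -
  have *: "a * cnj a + b * cnj b + a * cnj b * f x + b * cnj a * f (- x) \<in> \<real>\<^sub>\<ge>\<^sub>0" for a b
  proof -
    have "(\<Sum>j=1..2. \<Sum>k=1..2. (if j = 1 then a else b) * cnj (if k = (1::nat) then a else b) *
        f ((if j = (1::nat) then x else 0) - (if k = 1 then x else 0))) \<in> \<real>\<^sub>\<ge>\<^sub>0"
      using assms(1)[unfolded pos_def_fun_def, rule_format, where m = 2
          and z = "\<lambda>j. if j = 1 then a else b" and x = "\<lambda>j. if j = 1 then x else 0"] .
    moreover have "{1..2} = {1, 2::nat}" by auto
    ultimately show ?thesis
      using assms(2) by (simp add: algebra_simps)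
  qed
  show "f (- x) = cnj (f x)" "cmod (f x) \<le> 1"
    using two_point_pos_def[OF *] by auto
qed

lemma pos_def_seq_bounds:
  assumes "pos_def_seq c" "c 0 = 1"
  shows "c (- n) = cnj (c n)" and "cmod (c n) \<le> 1"
proof -
  have "c (- n) = cnj (c n) \<and> cmod (c n) \<le> 1"
  proof (cases "n = 0")
    case False
    have *: "a * cnj a + b * cnj b + a * cnj b * c n + b * cnj a * c (- n) \<in> \<real>\<^sub>\<ge>\<^sub>0" for a b
    proof -
      have "(\<Sum>j\<in>{n, 0}. \<Sum>k\<in>{n, 0}. (if j = n then a else b) * cnj (if k = n then a else b) *
          c (j - k)) \<in> \<real>\<^sub>\<ge>\<^sub>0"
        using assms(1)[unfolded pos_def_seq_def, rule_format, of "{n, 0}" "\<lambda>j. if j = n then a else b"]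
        by simp
      then show ?thesis
        using assms(2) False by (simp add: algebra_simps)
    qed
    show ?thesis using two_point_pos_def[OF *] by auto
  qed (use assms in auto)
  then show "c (- n) = cnj (c n)" "cmod (c n) \<le> 1" by auto
qed

lemma turan_fun_integrable:
  assumes "f \<in> turan_fun_class \<Omega>" "bounded \<Omega>"
  shows "integrable lborel f"
proof -
  let ?K = "closure {x. f x \<noteq> 0}"
  have "compact ?K"
    using assms bounded_subset unfolding turan_fun_class_def compact_eq_bounded_closed by auto
  moreover have "continuous_on ?K f"
    using assms continuous_on_subset unfolding turan_fun_class_def by blast
  ultimately have "integrable lborel (\<lambda>x. indicator ?K x *\<^sub>R f x)"
    by (rule borel_integrable_compact)
  moreover have "(\<lambda>x. indicator ?K x *\<^sub>R f x) = f"
    using closure_subset[of "{x. f x \<noteq> 0}"] by (auto simp: indicator_def fun_eq_iff)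
  ultimately show ?thesis by simp
qed

lemma turan_fun_integral_real:
  assumes "f \<in> turan_fun_class \<Omega>"
  shows "(\<integral>x. f x \<partial>lborel) \<in> \<real>"
proof -
  have "cnj (\<integral>x. f x \<partial>lborel) = (\<integral>x. cnj (f x) \<partial>lborel)" by simp
  also have "\<dots> = (\<integral>x. f (0 + (- 1) * x) \<partial>lborel)"
    using assms pos_def_fun_bounds(1) unfolding turan_fun_class_def by auto
  also have "\<dots> = (\<integral>x. f x \<partial>lborel)"
    using lborel_integral_real_affine[of "-1" f 0] by simp
  finally show ?thesis by (simp add: Reals_cnj_iff)
qed

lemma turan_fun_bdd_above:
  assumes "open \<Omega>" "bounded \<Omega>"
  shows "bdd_above ((\<lambda>f. Re (\<integral>x. f x \<partial>lborel)) ` turan_fun_class \<Omega>)"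
proof (rule bdd_aboveI2)
  fix f assume f: "f \<in> turan_fun_class \<Omega>"
  have fin: "emeasure lborel \<Omega> < \<infinity>" by (rule emeasure_bounded_finite[OF assms(2)])
  have "Re (\<integral>x. f x \<partial>lborel) \<le> cmod (\<integral>x. f x \<partial>lborel)" by (rule complex_Re_le_cmod)
  also have "\<dots> \<le> (\<integral>x. cmod (f x) \<partial>lborel)" by (rule integral_norm_bound)
  also have "\<dots> \<le> (\<integral>x. indicator \<Omega> x \<partial>lborel)"
  proof (rule integral_mono')
    show "integrable lborel (indicator \<Omega> :: real \<Rightarrow> real)"
      using fin assms(1) by (simp add: less_top)
    fix x
    show "cmod (f x) \<le> indicator \<Omega> x"
      using f pos_def_fun_bounds(2)[of f x] closure_subset[of "{x. f x \<noteq> 0}"]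
      unfolding turan_fun_class_def by (auto simp: indicator_def)
  qed simp
  finally show "Re (\<integral>x. f x \<partial>lborel) \<le> (\<integral>x. indicator \<Omega> x \<partial>lborel)" .
qed

lemma turan_fun_class_nonempty:
  assumes "open \<Omega>" "0 \<in> \<Omega>"
  shows "turan_fun_class \<Omega> \<noteq> {}"
proof -
  obtain a where a: "a > 0" "cball 0 a \<subseteq> \<Omega>"
    using assms open_contains_cball by blast
  define g where "g x = max 0 (1 - \<bar>x\<bar> / a)" for x :: real
  define I where "I y t = (indicator {y..y + a} t :: real)" for y t :: real
  have Iint: "integrable lborel (\<lambda>t. I u t * I v t)"
    and Ival: "(\<integral>t. I u t * I v t \<partial>lborel) = a * g (u - v)" for u v
  proof -
    have *: "I u t * I v t = indicator {max u v..min u v + a} t" for t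
      by (auto simp: I_def indicator_def)
    show "integrable lborel (\<lambda>t. I u t * I v t)" unfolding *
      by (rule integrable_real_indicator) (auto simp: emeasure_lborel_Icc_eq)
    show "(\<integral>t. I u t * I v t \<partial>lborel) = a * g (u - v)"
      unfolding * using a(1) by (auto simp: g_def max_def min_def field_simps abs_if)
  qed
  have "pos_def_fun (\<lambda>x. complex_of_real (g x))"
    unfolding pos_def_fun_def
  proof (intro allI)
    fix m :: nat and x :: "nat \<Rightarrow> real" and z :: "nat \<Rightarrow> complex"
    let ?S = "\<Sum>j=1..m. \<Sum>k=1..m. z j * cnj (z k) * complex_of_real (g (x j - x k))"
    let ?h = "\<lambda>t. \<Sum>j=1..m. z j * complex_of_real (I (x j) t)"
    have "complex_of_real a * ?S =
        (\<Sum>j=1..m. \<Sum>k=1..m. z j * cnj (z k) * complex_of_real (\<integral>t. I (x j) t * I (x k) t \<partial>lborel))"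
      unfolding Ival by (simp add: sum_distrib_left mult_ac)
    also have "\<dots> = (\<Sum>j=1..m. \<Sum>k=1..m.
        (\<integral>t. z j * cnj (z k) * complex_of_real (I (x j) t * I (x k) t) \<partial>lborel))"
      by (simp only: integral_complex_of_real integral_mult_right_zero)
    also have "\<dots> = (\<integral>t. (\<Sum>j=1..m. \<Sum>k=1..m.
        z j * cnj (z k) * complex_of_real (I (x j) t * I (x k) t)) \<partial>lborel)"
      using Iint by (subst Bochner_Integration.integral_sum
          | intro Bochner_Integration.integrable_sum integrable_mult_right integrable_of_real
          | simp del: of_real_mult)+
    also have "\<dots> = (\<integral>t. complex_of_real ((cmod (?h t))\<^sup>2) \<partial>lborel)"
      by (intro Bochner_Integration.integral_cong refl)
        (unfold complex_norm_square, simp add: sum_product mult_ac)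
    also have "\<dots> = complex_of_real (\<integral>t. (cmod (?h t))\<^sup>2 \<partial>lborel)"
      by (rule integral_complex_of_real)
    finally have "?S = complex_of_real ((\<integral>t. (cmod (?h t))\<^sup>2 \<partial>lborel) / a)"
      using a(1) by (simp add: field_simps)
    also have "\<dots> \<in> \<real>\<^sub>\<ge>\<^sub>0"
      using a(1) by (simp add: nonneg_Reals_of_real_iff)
    finally show "?S \<in> \<real>\<^sub>\<ge>\<^sub>0" .
  qed
  moreover have "continuous_on UNIV (\<lambda>x. complex_of_real (g x))"
    unfolding g_def using a(1) by (intro continuous_intros) auto
  moreover have "closure {x. complex_of_real (g x) \<noteq> 0} \<subseteq> \<Omega>"
  proof -
    have "{x. complex_of_real (g x) \<noteq> 0} \<subseteq> cball 0 a"
      using a(1) by (auto simp: g_def max_def field_simps split: if_splits)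
    then show ?thesis using a(2) closure_minimal[OF _ closed_cball] by blast
  qed
  ultimately have "(\<lambda>x. complex_of_real (g x)) \<in> turan_fun_class \<Omega>"
    unfolding turan_fun_class_def by (simp add: g_def)
  then show ?thesis by blast
qed

lemma turan_seq_sum_real:
  assumes "c \<in> turan_seq_class A" "uminus ` A = A"
  shows "(\<Sum>n\<in>A. c n) \<in> \<real>"
proof -
  have "cnj (\<Sum>n\<in>A. c n) = (\<Sum>n\<in>A. c (- n))"
    using assms(1) pos_def_seq_bounds(1) unfolding turan_seq_class_def by (simp add: cnj_sum)
  also have "\<dots> = (\<Sum>n\<in>uminus ` A. c n)"
    by (subst sum.reindex) (auto simp: inj_on_def)
  finally show ?thesis using assms(2) by (simp add: Reals_cnj_iff)
qed

lemma turan_seq_bdd_above: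
  "bdd_above ((\<lambda>c. Re (\<Sum>n\<in>A. c n)) ` turan_seq_class A)"
proof (rule bdd_aboveI2)
  fix c assume c: "c \<in> turan_seq_class A"
  have "Re (\<Sum>n\<in>A. c n) \<le> cmod (\<Sum>n\<in>A. c n)" by (rule complex_Re_le_cmod)
  also have "\<dots> \<le> (\<Sum>n\<in>A. 1)"
    by (rule sum_norm_le) (use c pos_def_seq_bounds(2) in \<open>auto simp: turan_seq_class_def\<close>)
  finally show "Re (\<Sum>n\<in>A. c n) \<le> (\<Sum>n\<in>A. 1)" .
qed

lemma turan_seq_class_nonempty:
  assumes "0 \<in> A"
  shows "turan_seq_class A \<noteq> {}"
proof -
  have "pos_def_seq (\<lambda>n. if n = 0 then 1 else 0)"
    unfolding pos_def_seq_def
  proof (intro allI impI)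
    fix S :: "int set" and z :: "int \<Rightarrow> complex" assume "finite S"
    then have "(\<Sum>m\<in>S. \<Sum>n\<in>S. z m * cnj (z n) * (if m - n = 0 then 1 else 0)) =
        (\<Sum>m\<in>S. z m * cnj (z m))"
      by (simp add: if_distrib cong: if_cong)
    also have "\<dots> = complex_of_real (\<Sum>m\<in>S. (cmod (z m))\<^sup>2)"
      by (simp only: of_real_sum complex_norm_square)
    also have "\<dots> \<in> \<real>\<^sub>\<ge>\<^sub>0" by (simp only: nonneg_Reals_of_real_iff) (simp add: sum_nonneg)
    finally show "(\<Sum>m\<in>S. \<Sum>n\<in>S. z m * cnj (z n) * (if m - n = 0 then 1 else 0)) \<in> \<real>\<^sub>\<ge>\<^sub>0" .
  qed
  then have "(\<lambda>n. if n = 0 then 1 else 0) \<in> turan_seq_class A"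
    using assms by (auto simp: turan_seq_class_def)
  then show ?thesis by blast
qed

end

theory Submission
  imports Defs
begin

text \<open>
  Write \<open>h = 1/q\<close>. The points of the lattice \<open>h\<int>\<close> that lie in \<open>\<Omega>\<^sub>p\<^sub>/\<^sub>q\<close> are exactly the \<open>nh\<close> with
  \<open>n \<in> A\<^sub>p\<^sub>,\<^sub>q\<close>, and the ball of radius \<open>h\<close> around each of them is still contained in \<open>\<Omega>\<^sub>p\<^sub>/\<^sub>q\<close>,
  because the endpoints of the three intervals are lattice points. Each inequality needs one of
  these two facts.

  Upper bound (\<open>turan_const_real_le\<close>). If \<open>f\<close> is admissible for \<open>\<Omega>\<close>, then its samples
  \<open>c\<^sub>n = f(nh)\<close> are admissible for \<open>A\<close>, so it suffices that \<open>\<integral>f \<le> h \<Sum> f(nh)\<close>. Poisson summation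
  suggests this: the right side is the sum of the Fourier transform of \<open>f\<close>, which is nonnegative,
  over the dual lattice, and the left side is the term at \<open>0\<close>. A finite form of the argument avoids
  the Fourier transform of \<open>f\<close>. On the finer lattice of step \<open>h/M\<close>, the symbol \<open>\<Sum> c\<^sub>k w\<^sup>k\<close> of the
  sampled sequence is nonnegative on the unit circle; summing it over the \<open>M\<close>-th roots of unity keeps
  only the samples on \<open>h\<int>\<close>, and dropping all roots but \<open>w = 1\<close> bounds the fine Riemann sum by the
  coarse one (\<open>pos_def_seq_sum_le_sum_multiples\<close>). As \<open>M\<close> grows, the fine Riemann sums tend to the
  integral.

  Lower bound (\<open>turan_const_real_ge\<close>). Given \<open>c\<close> admissible for \<open>A\<close>, put a triangle of height \<open>c\<^sub>n\<close>
  and half-width \<open>r < h\<close> on each lattice point \<open>nh\<close>. The result is positive definite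
  (\<open>pos_def_fun_hat_sum\<close>), its integral is \<open>r \<Sum> c\<^sub>n\<close>, and its closed support lies in \<open>\<Omega>\<close> since \<open>r\<close> is
  strictly smaller than \<open>h\<close>. Then \<open>r\<close> tends to \<open>h\<close>.

  Both halves obtain their positivity from the same averaging principle,
  \<open>fejer_average_nonneg\<close>.
\<close>

section \<open>Summing positive definite sequences\<close>

text \<open>
  For \<open>S\<close> an integer interval of length \<open>L\<close>, every row of the double sum whose index is not close to an
  endpoint contributes the full sum \<open>s\<close> of \<open>d\<close>. The number of remaining rows does not depend on \<open>L\<close>,
  and each of them is bounded, so the double sum divided by \<open>L\<close> tends to \<open>s\<close>.
\<close>

lemma fejer_average_nonneg:
  fixes d :: "int \<Rightarrow> complex"
  assumes "finite A" and supp: "\<And>n. n \<notin> A \<Longrightarrow> d n = 0"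
    and nonneg: "\<And>S. finite S \<Longrightarrow> (\<Sum>m\<in>S. \<Sum>n\<in>S. d (m - n)) \<in> \<real>\<^sub>\<ge>\<^sub>0"
  shows "(\<Sum>n\<in>A. d n) \<in> \<real>\<^sub>\<ge>\<^sub>0"
proof -
  define s where "s = (\<Sum>n\<in>A. d n)"
  define B where "B = (\<Sum>n\<in>A. cmod (d n))"
  obtain K where K: "A \<subseteq> {-int K..int K}"
  proof -
    have "finite ((\<lambda>n. nat \<bar>n\<bar>) ` A)" using assms(1) by simp
    then obtain K where "\<forall>n\<in>(\<lambda>n. nat \<bar>n\<bar>) ` A. n \<le> K" using finite_nat_set_iff_bounded_le by blast
    then have "A \<subseteq> {-int K..int K}" by force
    then show ?thesis by (rule that)
  qed
  have row_bound: "cmod (\<Sum>n\<in>S. d (m - n)) \<le> B" if "finite S" for m and S :: "int set"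
  proof -
    have "cmod (\<Sum>n\<in>S. d (m - n)) \<le> (\<Sum>n\<in>S. cmod (d (m - n)))" by (rule norm_sum)
    also have "\<dots> = (\<Sum>k\<in>(\<lambda>n. m - n) ` S. cmod (d k))"
      by (subst sum.reindex) (auto simp: inj_on_def)
    also have "\<dots> = (\<Sum>k\<in>(\<lambda>n. m - n) ` S \<inter> A. cmod (d k))"
      using that supp by (intro sum.mono_neutral_right) auto
    also have "\<dots> \<le> B" unfolding B_def
      using assms(1) by (intro sum_mono2) auto
    finally show ?thesis .
  qed
  have row_sum: "(\<Sum>n\<in>S. d (m - n)) = s" if "finite S" "{m - int K..m + int K} \<subseteq> S" for m S
  proof -
    have "(\<Sum>n\<in>S. d (m - n)) = (\<Sum>k\<in>(\<lambda>n. m - n) ` S. d k)"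
      by (subst sum.reindex) (auto simp: inj_on_def)
    also have "\<dots> = s" unfolding s_def
    proof (intro sum.mono_neutral_right ballI)
      show "A \<subseteq> (\<lambda>n. m - n) ` S"
      proof
        fix k assume "k \<in> A"
        then have "m - k \<in> S" using K that(2) by (force simp: subset_iff)
        then show "k \<in> (\<lambda>n. m - n) ` S" by (rule rev_image_eqI) simp
      qed
    qed (use that supp in auto)
    finally show ?thesis .
  qed
  have avg: "\<exists>e. cmod e \<le> 2 * real K * B \<and> of_nat N * s + e \<in> \<real>\<^sub>\<ge>\<^sub>0" for N :: nat
  proof -
    (* T indexes N complete rows; the 2K rows of S - T are the boundary effect. *)
    define S where "S = {-int K..<int N + int K}"
    define T where "T = {0..<int N}"
    define e where "e = (\<Sum>m\<in>S - T. \<Sum>n\<in>S. d (m - n))"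
    have "finite S" "T \<subseteq> S" by (auto simp: S_def T_def)
    have "(\<Sum>m\<in>S. \<Sum>n\<in>S. d (m - n)) = e + (\<Sum>m\<in>T. \<Sum>n\<in>S. d (m - n))"
      unfolding e_def by (rule sum.subset_diff) fact+
    also have "(\<Sum>m\<in>T. \<Sum>n\<in>S. d (m - n)) = (\<Sum>m\<in>T. s)"
      by (intro sum.cong row_sum) (auto simp: S_def T_def)
    also have "\<dots> = of_nat N * s" by (simp add: T_def)
    finally have "of_nat N * s + e \<in> \<real>\<^sub>\<ge>\<^sub>0"
      using nonneg[OF \<open>finite S\<close>] by (simp add: add.commute)
    moreover have "cmod e \<le> (\<Sum>m\<in>S - T. B)"
      unfolding e_def by (rule sum_norm_le) (rule row_bound[OF \<open>finite S\<close>])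
    moreover have "card (S - T) = 2 * K"
      using \<open>T \<subseteq> S\<close> by (subst card_Diff_subset) (auto simp: S_def T_def)
    ultimately show ?thesis by auto
  qed
  then obtain e where e: "\<And>N. cmod (e N) \<le> 2 * real K * B" "\<And>N. of_nat N * s + e N \<in> \<real>\<^sub>\<ge>\<^sub>0"
    by metis
  have "(\<lambda>N. s + e (Suc N) / of_nat (Suc N)) \<longlonglongrightarrow> s + 0"
  proof (intro tendsto_intros tendsto_norm_zero_cancel[where f = "\<lambda>N. e (Suc N) / of_nat (Suc N)"])
    show "(\<lambda>N. cmod (e (Suc N) / of_nat (Suc N))) \<longlonglongrightarrow> 0"
    proof (rule tendsto_sandwich[OF _ _ tendsto_const])
      show "(\<lambda>N. (2 * real K * B) / real (Suc N)) \<longlonglongrightarrow> 0"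
        by (rule LIMSEQ_Suc[OF lim_const_over_n])
      show "\<forall>\<^sub>F N in sequentially. cmod (e (Suc N) / of_nat (Suc N)) \<le> (2 * real K * B) / real (Suc N)"
        using e(1) by (intro always_eventually allI)
          (simp only: norm_divide norm_of_nat divide_right_mono of_nat_0_le_iff)
    qed simp
  qed
  moreover have "s + e (Suc N) / of_nat (Suc N) \<in> \<real>\<^sub>\<ge>\<^sub>0" for N
  proof -
    have "s + e (Suc N) / of_nat (Suc N) = (of_nat (Suc N) * s + e (Suc N)) / of_nat (Suc N)"
      by (simp add: field_simps del: of_nat_Suc)
    also have "\<dots> \<in> \<real>\<^sub>\<ge>\<^sub>0"
      by (intro nonneg_Reals_divide_I e(2)) (simp del: of_nat_Suc)
    finally show ?thesis .
  qed
  ultimately have "s \<in> \<real>\<^sub>\<ge>\<^sub>0"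
    using closed_sequentially[OF closed_nonneg_Reals_complex] by fastforce
  then show ?thesis by (simp add: s_def)
qed

text \<open>
  The trivial half of Herglotz' theorem: multiplying \<open>c\<close> by the character \<open>n \<mapsto> w\<^sup>n\<close> amounts to twisting
  the weights in the definition of positive definiteness, so that \<open>c\<^sub>n w\<^sup>n\<close> can be averaged.
\<close>

lemma pos_def_seq_symbol_nonneg:
  assumes c: "pos_def_seq c" and "finite A" "\<And>n. n \<notin> A \<Longrightarrow> c n = 0" and w: "cmod w = 1"
  shows "(\<Sum>n\<in>A. c n * w powi n) \<in> \<real>\<^sub>\<ge>\<^sub>0"
proof (rule fejer_average_nonneg)
  fix S :: "int set" assume S: "finite S"
  have "w \<noteq> 0" using w by auto
  have cnjw: "cnj (w powi n) = w powi (- n)" for n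
  proof -
    have "cnj w = inverse w"
      using w complex_norm_square[of w] \<open>w \<noteq> 0\<close> by (simp add: field_simps)
    then show ?thesis by (simp add: power_int_minus power_int_inverse)
  qed
  have "(\<Sum>m\<in>S. \<Sum>n\<in>S. c (m - n) * w powi (m - n)) =
      (\<Sum>m\<in>S. \<Sum>n\<in>S. w powi m * cnj (w powi n) * c (m - n))"
    unfolding cnjw using \<open>w \<noteq> 0\<close>
    by (simp add: power_int_diff power_int_minus field_simps)
  also have "\<dots> \<in> \<real>\<^sub>\<ge>\<^sub>0"
    using c S unfolding pos_def_seq_def by blast
  finally show "(\<Sum>m\<in>S. \<Sum>n\<in>S. c (m - n) * w powi (m - n)) \<in> \<real>\<^sub>\<ge>\<^sub>0" .
qed (use assms in auto)

lemma roots_of_unity_filter: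
  fixes M :: nat and k :: int
  assumes "M > 0"
  shows "(\<Sum>j<M. cis (2 * pi * real j / real M) powi k) = (if int M dvd k then of_nat M else 0)"
proof -
  define w where "w = cis (2 * pi * of_int k / real M)"
  have "(\<Sum>j<M. cis (2 * pi * real j / real M) powi k) = (\<Sum>j<M. w ^ j)"
    by (simp add: w_def cis_power_int Complex.DeMoivre mult_ac)
  moreover have "w = 1 \<longleftrightarrow> int M dvd k"
  proof
    assume "w = 1"
    then have "cos (2 * pi * of_int k / real M) = 1" by (simp add: w_def complex_eq_iff)
    then obtain x :: int where "2 * pi * of_int k / real M = of_int x * 2 * pi"
      unfolding cos_one_2pi_int by auto
    then have "real_of_int k = real_of_int (int M * x)"
      using assms by (simp add: field_simps)
    then show "int M dvd k" by (simp only: of_int_eq_iff) simp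
  next
    assume "int M dvd k"
    then obtain x where "k = int M * x" by blast
    then have "w = cis (2 * pi * of_int x)" using assms by (simp add: w_def field_simps)
    then show "w = 1" by (simp add: cis_multiple_2pi)
  qed
  moreover have "w ^ M = 1"
    using assms by (simp add: w_def Complex.DeMoivre cis_multiple_2pi)
  ultimately show ?thesis
    by (auto simp: sum_gp_strict)
qed

text \<open>
  With \<open>P(w) = \<Sum> c\<^sub>n w\<^sup>n\<close>, the right side is \<open>\<Sum> P(w)\<close> over the \<open>M\<close>-th roots of unity, all of whose terms
  are nonnegative, and the left side is its term \<open>P(1)\<close>. This is the discrete substitute for
  Poisson summation.
\<close>

lemma pos_def_seq_sum_le_sum_multiples:
  assumes c: "pos_def_seq c" and A: "finite A" "\<And>n. n \<notin> A \<Longrightarrow> c n = 0" and M: "M > 0"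
  shows "Re (\<Sum>n\<in>A. c n) \<le> real M * Re (\<Sum>n\<in>{n\<in>A. int M dvd n}. c n)"
proof -
  define P where "P j = (\<Sum>n\<in>A. c n * cis (2 * pi * real j / real M) powi n)" for j
  have "Re (\<Sum>n\<in>A. c n) = Re (P 0)" by (simp add: P_def)
  also have "\<dots> \<le> (\<Sum>j<M. Re (P j))"
  proof (rule member_le_sum)
    show "0 \<le> Re (P j)" for j
      using pos_def_seq_symbol_nonneg[OF c A, of "cis (2 * pi * real j / real M)"]
      by (simp add: P_def complex_nonneg_Reals_iff)
  qed (use M in auto)
  also have "\<dots> = Re (\<Sum>n\<in>A. c n * (\<Sum>j<M. cis (2 * pi * real j / real M) powi n))"
    unfolding P_def Re_sum[symmetric] by (subst sum.swap) (simp add: sum_distrib_left)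
  also have "\<dots> = Re (\<Sum>n\<in>A. if int M dvd n then of_nat M * c n else 0)"
    unfolding roots_of_unity_filter[OF M] by (intro arg_cong[where f = Re] sum.cong) auto
  also have "\<dots> = Re (of_nat M * (\<Sum>n\<in>{n\<in>A. int M dvd n}. c n))"
    unfolding sum_distrib_left by (subst sum.inter_filter[OF A(1)]) rule
  finally show ?thesis by simp
qed

section \<open>Sampling a positive definite function\<close>

text \<open>
  The two definitions index their test points differently, by \<open>1,\<dots>,m\<close> and by a finite set; an
  enumeration of the set translates one into the other.
\<close>

lemma pos_def_fun_sample:
  assumes "pos_def_fun f"
  shows "pos_def_seq (\<lambda>n. f (of_int n * h))"
  unfolding pos_def_seq_def
proof (intro allI impI)
  fix S :: "int set" and z :: "int \<Rightarrow> complex" assume "finite S"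
  then obtain g where g: "bij_betw g {1..card S} S"
    using ex_bij_betw_nat_finite_1 by blast
  have reindex: "(\<Sum>j=1..card S. F (g j)) = (\<Sum>m\<in>S. F m)" for F :: "int \<Rightarrow> complex"
    by (rule sum.reindex_bij_betw[OF g])
  have "(\<Sum>j=1..card S. \<Sum>k=1..card S. z (g j) * cnj (z (g k)) *
      f (of_int (g j) * h - of_int (g k) * h)) \<in> \<real>\<^sub>\<ge>\<^sub>0"
    using assms[unfolded pos_def_fun_def, rule_format, where m = "card S"
        and z = "\<lambda>j. z (g j)" and x = "\<lambda>j. of_int (g j) * h"] .
  then have "(\<Sum>m\<in>S. \<Sum>n\<in>S. z m * cnj (z n) * f (of_int m * h - of_int n * h)) \<in> \<real>\<^sub>\<ge>\<^sub>0"
    unfolding reindex[of "\<lambda>n. z (g j) * cnj (z n) * f (of_int (g j) * h - of_int n * h)" for j]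
      reindex[of "\<lambda>m. \<Sum>n\<in>S. z m * cnj (z n) * f (of_int m * h - of_int n * h)"] .
  then show "(\<Sum>m\<in>S. \<Sum>n\<in>S. z m * cnj (z n) * f (of_int (m - n) * h)) \<in> \<real>\<^sub>\<ge>\<^sub>0"
    by (simp add: left_diff_distrib)
qed

lemma integral_grid_step_function:
  fixes f :: "real \<Rightarrow> complex"
  assumes "\<delta> > 0" "finite A" and supp: "\<And>k. k \<notin> A \<Longrightarrow> f (of_int k * \<delta>) = 0"
  shows "(\<integral>x. f (of_int \<lfloor>x / \<delta>\<rfloor> * \<delta>) \<partial>lborel) = of_real \<delta> * (\<Sum>k\<in>A. f (of_int k * \<delta>))"
proof -
  define J where "J k = {of_int k * \<delta>..<(of_int k + 1) * \<delta>}" for k :: int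
  have J: "x \<in> J k \<longleftrightarrow> \<lfloor>x / \<delta>\<rfloor> = k" for x k
    using assms(1) by (auto simp: J_def floor_eq_iff field_simps)
  have step: "f (of_int \<lfloor>x / \<delta>\<rfloor> * \<delta>) = (\<Sum>k\<in>A. indicator (J k) x *\<^sub>R f (of_int k * \<delta>))" for x
  proof -
    have "(\<Sum>k\<in>A. indicator (J k) x *\<^sub>R f (of_int k * \<delta>)) =
        (\<Sum>k\<in>A. if k = \<lfloor>x / \<delta>\<rfloor> then f (of_int k * \<delta>) else 0)"
      by (intro sum.cong) (auto simp: J indicator_def)
    also have "\<dots> = f (of_int \<lfloor>x / \<delta>\<rfloor> * \<delta>)"
      using assms(2) supp by simp
    finally show ?thesis by simp
  qed
  have J_sets: "J k \<in> sets lborel" and J_measure: "measure lborel (J k) = \<delta>"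
    and J_fin: "emeasure lborel (J k) < \<infinity>" for k
    using assms(1) by (simp_all add: J_def algebra_simps)
  have "(\<integral>x. f (of_int \<lfloor>x / \<delta>\<rfloor> * \<delta>) \<partial>lborel) =
      (\<Sum>k\<in>A. \<integral>x. indicator (J k) x *\<^sub>R f (of_int k * \<delta>) \<partial>lborel)"
    unfolding step using J_sets J_fin
    by (intro Bochner_Integration.integral_sum integrable_indicator[THEN integrable_scaleR_left]) auto
  also have "\<dots> = (\<Sum>k\<in>A. \<delta> *\<^sub>R f (of_int k * \<delta>))"
    using J_sets J_fin by (simp add: J_measure)
  finally show ?thesis by (simp add: sum_distrib_left scaleR_conv_of_real)
qed

text \<open>
  Each grid sum is the integral of the step function that evaluates \<open>f\<close> at the grid point to the left.
  These step functions converge pointwise to \<open>f\<close> and, since no step is wider than \<open>h\<close>, they are all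
  dominated by \<open>B\<close> on \<open>[-R - h, R + h]\<close>.
\<close>

lemma grid_sums_tendsto_integral:
  fixes f :: "real \<Rightarrow> complex"
  assumes cont: "continuous_on UNIV f" and bound: "\<And>x. cmod (f x) \<le> B"
    and supp: "\<And>x. \<bar>x\<bar> > R \<Longrightarrow> f x = 0" and "h > 0"
    and A: "\<And>M. finite (A M)" "\<And>M k. k \<notin> A M \<Longrightarrow> f (of_int k * (h / Suc M)) = 0"
  shows "(\<lambda>M. of_real (h / Suc M) * (\<Sum>k\<in>A M. f (of_int k * (h / Suc M)))) \<longlonglongrightarrow> (\<integral>x. f x \<partial>lborel)"
proof -
  define \<delta> where "\<delta> M = h / Suc M" for M
  have \<delta>: "\<delta> M > 0" "\<delta> M \<le> h" for M
    using \<open>h > 0\<close> by (auto simp: \<delta>_def field_simps)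
  have near: "\<bar>of_int \<lfloor>x / \<delta> M\<rfloor> * \<delta> M - x\<bar> \<le> \<delta> M" for x M
  proof -
    have "\<bar>of_int \<lfloor>x / \<delta> M\<rfloor> - x / \<delta> M\<bar> \<le> 1" by linarith
    then have "\<bar>of_int \<lfloor>x / \<delta> M\<rfloor> - x / \<delta> M\<bar> * \<delta> M \<le> 1 * \<delta> M"
      using \<delta>(1)[of M] by (intro mult_right_mono) auto
    moreover have "\<bar>of_int \<lfloor>x / \<delta> M\<rfloor> - x / \<delta> M\<bar> * \<delta> M = \<bar>(of_int \<lfloor>x / \<delta> M\<rfloor> - x / \<delta> M) * \<delta> M\<bar>"
      using \<delta>(1)[of M] by (simp add: abs_mult)
    moreover have "(of_int \<lfloor>x / \<delta> M\<rfloor> - x / \<delta> M) * \<delta> M = of_int \<lfloor>x / \<delta> M\<rfloor> * \<delta> M - x"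
      using \<delta>(1)[of M] by (simp add: field_simps)
    ultimately show ?thesis by simp
  qed
  have \<delta>0: "\<delta> \<longlonglongrightarrow> 0"
    unfolding \<delta>_def by (rule LIMSEQ_Suc[OF lim_const_over_n])
  have [measurable]: "f \<in> borel_measurable borel"
    using cont by (rule borel_measurable_continuous_onI)
  have "(\<lambda>M. \<integral>x. f (of_int \<lfloor>x / \<delta> M\<rfloor> * \<delta> M) \<partial>lborel) \<longlonglongrightarrow> (\<integral>x. f x \<partial>lborel)"
  proof (rule integral_dominated_convergence[where w = "\<lambda>x. indicator {-(R + h)..R + h} x *\<^sub>R B"])
    show "integrable lborel (\<lambda>x. indicator {-(R + h)..R + h} x *\<^sub>R B :: real)"
      by (intro integrable_scaleR_left integrable_real_indicator) (auto simp: emeasure_lborel_Icc_eq)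
    show "AE x in lborel. (\<lambda>M. f (of_int \<lfloor>x / \<delta> M\<rfloor> * \<delta> M)) \<longlonglongrightarrow> f x"
    proof (rule AE_I2)
      fix x :: real
      have "(\<lambda>M. of_int \<lfloor>x / \<delta> M\<rfloor> * \<delta> M - x) \<longlonglongrightarrow> 0"
        using near by (intro Lim_null_comparison[OF _ \<delta>0] always_eventually) auto
      then have "(\<lambda>M. of_int \<lfloor>x / \<delta> M\<rfloor> * \<delta> M) \<longlonglongrightarrow> x" by (simp add: LIM_zero_iff)
      moreover have "isCont f x" using cont by (simp add: continuous_on_eq_continuous_at)
      ultimately show "(\<lambda>M. f (of_int \<lfloor>x / \<delta> M\<rfloor> * \<delta> M)) \<longlonglongrightarrow> f x"
        by (rule isCont_tendsto_compose[rotated])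
    qed
    show "AE x in lborel. cmod (f (of_int \<lfloor>x / \<delta> M\<rfloor> * \<delta> M)) \<le> indicator {-(R + h)..R + h} x *\<^sub>R B" for M
    proof (rule AE_I2)
      fix x :: real
      show "cmod (f (of_int \<lfloor>x / \<delta> M\<rfloor> * \<delta> M)) \<le> indicator {-(R + h)..R + h} x *\<^sub>R B"
      proof (cases "\<bar>x\<bar> \<le> R + h")
        case True
        then show ?thesis using bound by (auto simp: indicator_def)
      next
        case False
        then have "\<bar>of_int \<lfloor>x / \<delta> M\<rfloor> * \<delta> M\<bar> > R" using near[of x M] \<delta>(2)[of M] by linarith
        then show ?thesis using supp False by (auto simp: indicator_def)
      qed
    qed
  qed simp_all
  moreover have "(\<integral>x. f (of_int \<lfloor>x / \<delta> M\<rfloor> * \<delta> M) \<partial>lborel) =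
      of_real (h / Suc M) * (\<Sum>k\<in>A M. f (of_int k * (h / Suc M)))" for M
    using integral_grid_step_function[OF \<delta>(1) A(1)[of M], of f] A(2) by (simp add: \<delta>_def)
  ultimately show ?thesis by simp
qed

text \<open>
  The key inequality for the upper bound: refining the grid by any integer factor can only decrease
  the grid sum, and the refined sums tend to the integral.
\<close>

lemma pos_def_fun_integral_le_grid_sum:
  assumes f: "pos_def_fun f" "continuous_on UNIV f" "f 0 = 1"
    and supp: "\<And>x. \<bar>x\<bar> > R \<Longrightarrow> f x = 0" and "h > 0"
    and A: "finite A" "\<And>n. n \<notin> A \<Longrightarrow> f (of_int n * h) = 0"
  shows "Re (\<integral>x. f x \<partial>lborel) \<le> h * Re (\<Sum>n\<in>A. f (of_int n * h))"
proof -
  define \<delta> where "\<delta> M = h / Suc M" for M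
  have \<delta>: "\<delta> M > 0" for M using \<open>h > 0\<close> by (simp add: \<delta>_def)
  (* The second part of the union makes the coarse grid points of A occur among the multiples of
     Suc M in G M, even those where f vanishes. *)
  define G where "G M = {k :: int. \<bar>of_int k * \<delta> M\<bar> \<le> R} \<union> (\<lambda>n. int (Suc M) * n) ` A" for M
  have G_fin: "finite (G M)" for M
  proof -
    have "{k :: int. \<bar>of_int k * \<delta> M\<bar> \<le> R} \<subseteq> {- \<lceil>R / \<delta> M\<rceil>..\<lceil>R / \<delta> M\<rceil>}"
    proof
      fix k :: int assume "k \<in> {k. \<bar>of_int k * \<delta> M\<bar> \<le> R}"
      then have "\<bar>of_int k\<bar> \<le> R / \<delta> M"
        using \<delta>[of M] by (simp add: abs_mult field_simps)
      then show "k \<in> {- \<lceil>R / \<delta> M\<rceil>..\<lceil>R / \<delta> M\<rceil>}" by auto linarith+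
    qed
    then show ?thesis using A(1) by (auto simp: G_def intro: finite_subset)
  qed
  have G_supp: "f (of_int k * \<delta> M) = 0" if "k \<notin> G M" for k M
    using that supp by (auto simp: G_def)
  have "Re (of_real (\<delta> M) * (\<Sum>k\<in>G M. f (of_int k * \<delta> M))) \<le> h * Re (\<Sum>n\<in>A. f (of_int n * h))" for M
  proof -
    have coarse: "of_int (int (Suc M) * n) * \<delta> M = of_int n * h" for n
      by (simp add: \<delta>_def field_simps del: of_nat_Suc)
    have "(\<Sum>k\<in>{k\<in>G M. int (Suc M) dvd k}. f (of_int k * \<delta> M)) =
        (\<Sum>k\<in>(\<lambda>n. int (Suc M) * n) ` A. f (of_int k * \<delta> M))"
    proof (intro sum.mono_neutral_right ballI)
      fix k assume k: "k \<in> {k\<in>G M. int (Suc M) dvd k} - (\<lambda>n. int (Suc M) * n) ` A"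
      then obtain n where n: "k = int (Suc M) * n" by blast
      then have "n \<notin> A" using k by auto
      then show "f (of_int k * \<delta> M) = 0" unfolding n coarse by (rule A(2))
    qed (auto simp: G_fin, auto simp: G_def)
    also have "\<dots> = (\<Sum>n\<in>A. f (of_int n * h))"
      by (subst sum.reindex) (auto simp: inj_on_def coarse simp del: of_int_mult of_nat_Suc)
    finally have "Re (\<Sum>k\<in>G M. f (of_int k * \<delta> M)) \<le> real (Suc M) * Re (\<Sum>n\<in>A. f (of_int n * h))"
      using pos_def_seq_sum_le_sum_multiples[OF pos_def_fun_sample[OF f(1)] G_fin[of M]
          G_supp[where M = M] zero_less_Suc[of M]]
      by simp
    then have "\<delta> M * Re (\<Sum>k\<in>G M. f (of_int k * \<delta> M)) \<le>
        \<delta> M * (real (Suc M) * Re (\<Sum>n\<in>A. f (of_int n * h)))"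
      using \<delta>[of M] by (intro mult_left_mono) auto
    also have "\<dots> = h * Re (\<Sum>n\<in>A. f (of_int n * h))"
      by (simp add: \<delta>_def del: of_nat_Suc)
    finally show ?thesis by simp
  qed
  moreover have "(\<lambda>M. Re (of_real (\<delta> M) * (\<Sum>k\<in>G M. f (of_int k * \<delta> M)))) \<longlonglongrightarrow> Re (\<integral>x. f x \<partial>lborel)"
    unfolding \<delta>_def
    by (intro tendsto_Re grid_sums_tendsto_integral[OF f(2) pos_def_fun_bounds(2)[OF f(1,3)] supp \<open>h > 0\<close>]
        G_fin G_supp[unfolded \<delta>_def])
  ultimately show ?thesis by (intro LIMSEQ_le_const2) auto
qed

section \<open>Interpolating a positive definite sequence\<close>

definition hat :: "real \<Rightarrow> real \<Rightarrow> real" where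
  "hat r x = max 0 (1 - \<bar>x\<bar> / r)"

definition hat_sum :: "real \<Rightarrow> real \<Rightarrow> int set \<Rightarrow> (int \<Rightarrow> complex) \<Rightarrow> real \<Rightarrow> complex" where
  "hat_sum r h A c x = (\<Sum>n\<in>A. c n * of_real (hat r (x - of_int n * h)))"

lemma continuous_on_hat: "r > 0 \<Longrightarrow> continuous_on S (hat r)"
  unfolding hat_def by (intro continuous_intros) auto

lemma hat_eq_0: "r > 0 \<Longrightarrow> r \<le> \<bar>x\<bar> \<Longrightarrow> hat r x = 0"
  by (simp add: hat_def)

text \<open>
  Up to the factor \<open>r\<close>, the triangle is the autocorrelation of the indicator of an interval, which makes it
  positive definite.
\<close>

lemma hat_autocorrelation:
  assumes "r > 0"
  shows "integrable lborel (\<lambda>t. indicator {u..u + r} t * indicator {v..v + r} t :: real)"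
    and "(\<integral>t. indicator {u..u + r} t * indicator {v..v + r} t \<partial>lborel) = r * hat r (u - v)"
proof -
  have *: "indicator {u..u + r} t * indicator {v..v + r} t = (indicator {max u v..min u v + r} t :: real)" for t
    by (auto simp: indicator_def)
  show "integrable lborel (\<lambda>t. indicator {u..u + r} t * indicator {v..v + r} t :: real)"
    unfolding * by (rule integrable_real_indicator) (auto simp: emeasure_lborel_Icc_eq)
  show "(\<integral>t. indicator {u..u + r} t * indicator {v..v + r} t \<partial>lborel) = r * hat r (u - v)"
    unfolding * using assms by (auto simp: hat_def max_def min_def field_simps abs_if)
qed

lemma has_bochner_integral_hat:
  assumes "r > 0"
  shows "has_bochner_integral lborel (hat r) r"
proof -
  have eq: "hat r x = indicator {-r..0} x *\<^sub>R (1 + x / r) + indicator {0..r} x *\<^sub>R (1 - x / r)"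
    if "x \<noteq> 0" for x
    using that assms by (auto simp: hat_def indicator_def max_def field_simps)
  have cont: "isCont (\<lambda>x. 1 + x / r) x" "isCont (\<lambda>x. 1 - x / r) x" for x
    using assms by (auto intro!: continuous_intros)
  have "has_bochner_integral lborel (\<lambda>x. indicator {-r..0} x *\<^sub>R (1 + x / r)) (r / 2)"
  proof -
    have "((\<lambda>x. x + x\<^sup>2 / (2 * r)) has_real_derivative 1 + x / r) (at x)" for x
      using assms by (auto intro!: derivative_eq_intros)
    from has_bochner_integral_FTC_Icc_real[of "-r" 0, OF _ this cont(1)] show ?thesis
      using assms by (simp add: power2_eq_square mult.commute)
  qed
  moreover have "has_bochner_integral lborel (\<lambda>x. indicator {0..r} x *\<^sub>R (1 - x / r)) (r / 2)"
  proof -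
    have "((\<lambda>x. x - x\<^sup>2 / (2 * r)) has_real_derivative 1 - x / r) (at x)" for x
      using assms by (auto intro!: derivative_eq_intros)
    from has_bochner_integral_FTC_Icc_real[of 0 r, OF _ this cont(2)] show ?thesis
      using assms by (simp add: power2_eq_square mult.commute)
  qed
  ultimately have "has_bochner_integral lborel
      (\<lambda>x. indicator {-r..0} x *\<^sub>R (1 + x / r) + indicator {0..r} x *\<^sub>R (1 - x / r)) (r / 2 + r / 2)"
    by (rule has_bochner_integral_add)
  also have "r / 2 + r / 2 = r" by simp
  finally show ?thesis
  proof (subst has_bochner_integral_cong_AE)
    show "AE x in lborel. hat r x =
        indicator {-r..0} x *\<^sub>R (1 + x / r) + indicator {0..r} x *\<^sub>R (1 - x / r)"
      using AE_lborel_singleton[of 0] by eventually_elim (rule eq)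
  qed (use continuous_on_hat[OF assms] in \<open>auto intro: borel_measurable_continuous_onI\<close>)
qed

lemma integral_hat_sum:
  assumes "r > 0"
  shows "(\<integral>x. hat_sum r h A c x \<partial>lborel) = of_real r * (\<Sum>n\<in>A. c n)"
proof -
  have "has_bochner_integral lborel (\<lambda>x. hat r (x - s)) r" for s
    using lborel_has_bochner_integral_real_affine_iff[of 1 "hat r" r "-s"] has_bochner_integral_hat[OF assms]
    by simp
  then have "has_bochner_integral lborel (hat_sum r h A c) (\<Sum>n\<in>A. c n * of_real r)"
    unfolding hat_sum_def
    by (intro has_bochner_integral_sum has_bochner_integral_mult_right has_bochner_integral_of_real) auto
  then show ?thesis
    by (simp add: has_bochner_integral_integral_eq sum_distrib_left mult.commute)
qed

text \<open>
  If \<open>c\<close> were of the form \<open>b * b\<^sup>~\<close>, the sum of triangles would itself be an autocorrelation. Averaging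
  replaces such a factorisation: the quadratic form to be estimated is \<open>\<Sum> d\<^sub>n\<close>, where \<open>d\<^sub>n\<close>
  collects the terms with \<open>c\<^sub>n\<close>, so it suffices to treat \<open>\<Sum> d\<^sub>a\<^sub>-\<^sub>b\<close> over \<open>a, b \<in> S\<close>. There the
  triangle at \<open>(x\<^sub>j - ah) - (x\<^sub>k - bh)\<close> is an inner product of indicators of translated intervals, and
  under the integral sign there remains \<open>\<Sum> u\<^sub>a cnj(u\<^sub>b) c\<^sub>a\<^sub>-\<^sub>b\<close>, the quadratic form of \<open>c\<close>.
\<close>

lemma pos_def_fun_hat_sum:
  assumes c: "pos_def_seq c" and A: "finite A" "\<And>n. n \<notin> A \<Longrightarrow> c n = 0" and "r > 0"
  shows "pos_def_fun (hat_sum r h A c)"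
  unfolding pos_def_fun_def
proof (intro allI)
  fix m :: nat and x :: "nat \<Rightarrow> real" and z :: "nat \<Rightarrow> complex"
  define d where "d n = (\<Sum>j=1..m. \<Sum>k=1..m. z j * cnj (z k) * c n *
    of_real (hat r (x j - x k - of_int n * h)))" for n
  have "(\<Sum>n\<in>A. d n) \<in> \<real>\<^sub>\<ge>\<^sub>0"
  proof (rule fejer_average_nonneg[OF A(1)])
    show "d n = 0" if "n \<notin> A" for n using A(2)[OF that] by (simp add: d_def)
    fix S :: "int set" assume S: "finite S"
    define I where "I a j t = (indicator {x j - of_int a * h..x j - of_int a * h + r} t :: real)" for a j t
    define u where "u t a = (\<Sum>j=1..m. z j * of_real (I a j t))" for t a
    define Q where "Q t = (\<Sum>a\<in>S. \<Sum>b\<in>S. u t a * cnj (u t b) * c (a - b))" for t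
    have Q: "Q t \<in> \<real>\<^sub>\<ge>\<^sub>0" for t
      using c S unfolding Q_def pos_def_seq_def by blast
    have hatI: "has_bochner_integral lborel (\<lambda>t. z j * cnj (z k) * c (a - b) * of_real (I a j t * I b k t))
      (z j * cnj (z k) * c (a - b) * of_real (r * hat r (x j - x k - of_int (a - b) * h)))" for a b j k
    proof -
      have "has_bochner_integral lborel (\<lambda>t. I a j t * I b k t)
          (r * hat r ((x j - of_int a * h) - (x k - of_int b * h)))"
        unfolding I_def using hat_autocorrelation[OF \<open>r > 0\<close>]
        by (simp add: has_bochner_integral_iff)
      then show ?thesis
        by (intro has_bochner_integral_mult_right has_bochner_integral_of_real)
          (simp add: algebra_simps)
    qed
    have Q_eq: "Q t = (\<Sum>a\<in>S. \<Sum>b\<in>S. \<Sum>j=1..m. \<Sum>k=1..m.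
        z j * cnj (z k) * c (a - b) * of_real (I a j t * I b k t))" for t
      unfolding Q_def u_def cnj_sum sum_product sum_distrib_right
      by (intro sum.cong refl) (simp add: sum_distrib_left sum_distrib_right mult_ac)
    have "has_bochner_integral lborel Q (\<Sum>a\<in>S. \<Sum>b\<in>S. \<Sum>j=1..m. \<Sum>k=1..m.
        z j * cnj (z k) * c (a - b) * of_real (r * hat r (x j - x k - of_int (a - b) * h)))"
      unfolding Q_eq[abs_def] by (intro has_bochner_integral_sum hatI)
    then have "(\<integral>t. Q t \<partial>lborel) = of_real r * (\<Sum>a\<in>S. \<Sum>b\<in>S. d (a - b))"
      by (simp add: has_bochner_integral_integral_eq d_def sum_distrib_left mult_ac)
    moreover have "(\<integral>t. Q t \<partial>lborel) \<in> \<real>\<^sub>\<ge>\<^sub>0"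
    proof -
      have "Q t = of_real (Re (Q t))" "Re (Q t) \<ge> 0" for t
        using Q[of t] by (auto simp: complex_nonneg_Reals_iff complex_eq_iff)
      then have "(\<integral>t. Q t \<partial>lborel) = of_real (\<integral>t. Re (Q t) \<partial>lborel)" "(\<integral>t. Re (Q t) \<partial>lborel) \<ge> 0"
        by (metis (no_types, lifting) Bochner_Integration.integral_cong integral_complex_of_real,
            simp add: integral_nonneg_AE)
      then show ?thesis by (simp only: nonneg_Reals_of_real_iff)
    qed
    ultimately have "of_real r * (\<Sum>a\<in>S. \<Sum>b\<in>S. d (a - b)) \<in> \<real>\<^sub>\<ge>\<^sub>0" by simp
    then show "(\<Sum>a\<in>S. \<Sum>b\<in>S. d (a - b)) \<in> \<real>\<^sub>\<ge>\<^sub>0"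
      using \<open>r > 0\<close> by (simp add: complex_nonneg_Reals_iff zero_le_mult_iff)
  qed
  also have "(\<Sum>n\<in>A. d n) = (\<Sum>j=1..m. \<Sum>k=1..m. z j * cnj (z k) * hat_sum r h A c (x j - x k))"
  proof -
    have "(\<Sum>n\<in>A. d n) = (\<Sum>j=1..m. \<Sum>k=1..m. \<Sum>n\<in>A. z j * cnj (z k) * c n *
        of_real (hat r (x j - x k - of_int n * h)))"
      unfolding d_def by (subst sum.swap, intro sum.cong refl, subst sum.swap) rule
    then show ?thesis by (simp add: hat_sum_def sum_distrib_left mult.assoc)
  qed
  finally show "(\<Sum>j=1..m. \<Sum>k=1..m. z j * cnj (z k) * hat_sum r h A c (x j - x k)) \<in> \<real>\<^sub>\<ge>\<^sub>0" .
qed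

text \<open>
  The bound \<open>r < h\<close> keeps the triangles at the other lattice points away from \<open>0\<close>, so that the value
  there is \<open>c\<^sub>0\<close>.
\<close>

lemma hat_sum_in_turan_fun_class:
  assumes c: "c \<in> turan_seq_class A" and A: "finite A" "0 \<in> A" and r: "0 < r" "r < h"
    and sub: "\<And>n. n \<in> A \<Longrightarrow> cball (of_int n * h) r \<subseteq> \<Omega>"
  shows "hat_sum r h A c \<in> turan_fun_class \<Omega>"
proof -
  have "pos_def_seq c" "c 0 = 1" "\<And>n. n \<notin> A \<Longrightarrow> c n = 0"
    using c by (auto simp: turan_seq_class_def)
  then have "pos_def_fun (hat_sum r h A c)"
    using pos_def_fun_hat_sum A(1) r(1) by blast
  moreover have "continuous_on UNIV (hat_sum r h A c)"
    unfolding hat_sum_def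
    by (intro continuous_intros continuous_on_compose2[OF continuous_on_hat[OF r(1), of UNIV]]) auto
  moreover have "hat_sum r h A c 0 = 1"
  proof -
    have "hat r (0 - of_int n * h) = (if n = 0 then 1 else 0)" for n :: int
    proof (cases "n = 0")
      case False
      then have "1 * h \<le> \<bar>of_int n\<bar> * h"
        using r by (intro mult_right_mono) auto
      moreover have "\<bar>0 - of_int n * h\<bar> = \<bar>of_int n\<bar> * h" using r by (simp add: abs_mult)
      ultimately have "r \<le> \<bar>0 - of_int n * h\<bar>" using r by linarith
      then show ?thesis using False hat_eq_0[OF r(1)] by simp
    qed (simp add: hat_def)
    then have "hat_sum r h A c 0 = (\<Sum>n\<in>A. if n = 0 then c n else 0)"
      unfolding hat_sum_def by (intro sum.cong refl) simp
    then show ?thesis using A \<open>c 0 = 1\<close> by simp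
  qed
  moreover have "closure {x. hat_sum r h A c x \<noteq> 0} \<subseteq> \<Omega>"
  proof -
    have "{x. hat_sum r h A c x \<noteq> 0} \<subseteq> (\<Union>n\<in>A. cball (of_int n * h) r)"
    proof
      fix x assume "x \<in> {x. hat_sum r h A c x \<noteq> 0}"
      then obtain n where "n \<in> A" "hat r (x - of_int n * h) \<noteq> 0"
        unfolding hat_sum_def by (auto elim!: sum.not_neutral_contains_not_neutral)
      then show "x \<in> (\<Union>n\<in>A. cball (of_int n * h) r)"
        using hat_eq_0[OF r(1), of "x - of_int n * h"] by (force simp: dist_real_def)
    qed
    moreover have "closed (\<Union>n\<in>A. cball (of_int n * h) r)" using A(1) by auto
    ultimately show ?thesis using closure_minimal sub by blast
  qed
  ultimately show ?thesis by (simp add: turan_fun_class_def)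
qed

section \<open>Comparison of the two extremal problems\<close>

lemma turan_const_real_le:
  assumes \<Omega>: "open \<Omega>" "bounded \<Omega>" "0 \<in> \<Omega>" and "h > 0"
    and A: "finite A" "\<And>n. of_int n * h \<in> \<Omega> \<Longrightarrow> n \<in> A"
  shows "turan_const_real \<Omega> \<le> h * turan_const_int A"
  unfolding turan_const_real_def
proof (rule cSUP_least[OF turan_fun_class_nonempty[OF \<Omega>(1,3)]])
  fix f assume f: "f \<in> turan_fun_class \<Omega>"
  obtain R where R: "\<And>x. x \<in> \<Omega> \<Longrightarrow> \<bar>x\<bar> \<le> R" using \<Omega>(2) by (auto simp: bounded_iff)
  have off: "f x = 0" if "x \<notin> \<Omega>" for x
    using f that closure_subset[of "{x. f x \<noteq> 0}"] by (auto simp: turan_fun_class_def)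
  have f': "pos_def_fun f" "continuous_on UNIV f" "f 0 = 1" using f by (auto simp: turan_fun_class_def)
  have offA: "f (of_int n * h) = 0" if "n \<notin> A" for n using that A(2) off by blast
  have "(\<lambda>n. f (of_int n * h)) \<in> turan_seq_class A"
    using f' offA pos_def_fun_sample by (auto simp: turan_seq_class_def)
  then have "Re (\<Sum>n\<in>A. f (of_int n * h)) \<le> turan_const_int A"
    unfolding turan_const_int_def by (rule cSUP_upper[OF _ turan_seq_bdd_above])
  moreover have "Re (\<integral>x. f x \<partial>lborel) \<le> h * Re (\<Sum>n\<in>A. f (of_int n * h))"
    by (rule pos_def_fun_integral_le_grid_sum[OF f' _ \<open>h > 0\<close> A(1) offA, of R]) (use R off in force)
  ultimately show "Re (\<integral>x. f x \<partial>lborel) \<le> h * turan_const_int A"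
    using \<open>h > 0\<close> by (meson mult_le_cancel_left_pos order.trans)
qed

text \<open>
  Half-width \<open>h\<close> itself is excluded, as the closed support of the triangles could then leave the open
  set \<open>\<Omega>\<close>. Hence the half-width \<open>th\<close> with \<open>0 < t < 1\<close>, and the limit \<open>t \<rightarrow> 1\<close> in the inequality.
\<close>

lemma turan_const_real_ge:
  assumes \<Omega>: "open \<Omega>" "bounded \<Omega>" and "h > 0" and A: "finite A" "0 \<in> A"
    and sub: "\<And>n. n \<in> A \<Longrightarrow> ball (of_int n * h) h \<subseteq> \<Omega>"
  shows "h * turan_const_int A \<le> turan_const_real \<Omega>"
proof -
  have "Re (\<Sum>n\<in>A. c n) \<le> turan_const_real \<Omega> / h" if c: "c \<in> turan_seq_class A" for c
  proof -
    have "h * Re (\<Sum>n\<in>A. c n) \<le> turan_const_real \<Omega>"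
    proof (rule field_le_mult_one_interval)
      fix t :: real assume t: "0 < t" "t < 1"
      have r: "0 < t * h" "t * h < h" using t \<open>h > 0\<close> by auto
      then have "hat_sum (t * h) h A c \<in> turan_fun_class \<Omega>"
        using sub by (intro hat_sum_in_turan_fun_class[OF c A]) fastforce+
      then have "Re (\<integral>x. hat_sum (t * h) h A c x \<partial>lborel) \<le> turan_const_real \<Omega>"
        unfolding turan_const_real_def by (rule cSUP_upper[OF _ turan_fun_bdd_above[OF \<Omega>]])
      then show "t * (h * Re (\<Sum>n\<in>A. c n)) \<le> turan_const_real \<Omega>"
        unfolding integral_hat_sum[OF r(1)] by (simp add: mult.assoc)
    qed
    then show ?thesis using \<open>h > 0\<close> by (simp add: field_simps)
  qed
  then have "turan_const_int A \<le> turan_const_real \<Omega> / h"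
    unfolding turan_const_int_def by (rule cSUP_least[OF turan_seq_class_nonempty[OF A(2)]])
  then show ?thesis using \<open>h > 0\<close> by (simp add: field_simps)
qed

theorem theorem1p2:
  fixes p q :: nat
  assumes "p > 0" and "q > 0" and "coprime p q" and "real p / real q > 2"
  shows "turan_const_real (Omega_set (real p / real q)) = (1 / real q) * turan_const_int (A_set p q)"
proof (rule antisym)
  let ?\<Omega> = "Omega_set (real p / real q)" and ?A = "A_set p q" and ?h = "1 / real q"
  have \<Omega>: "open ?\<Omega>" "bounded ?\<Omega>" "0 \<in> ?\<Omega>"
    unfolding Omega_set_def by (simp_all add: open_Un)
  have h: "?h > 0" using assms(2) by simp
  have "?A \<subseteq> {-int (p + q)..int (p + q)}" by (auto simp: A_set_def)
  then have A: "finite ?A" "0 \<in> ?A" using assms(2) by (auto simp: A_set_def intro: finite_subset)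
  show "turan_const_real ?\<Omega> \<le> ?h * turan_const_int ?A"
  proof (rule turan_const_real_le[OF \<Omega> h A(1)])
    fix n :: int assume n: "of_int n * ?h \<in> ?\<Omega>"
    have near: "\<bar>n - s\<bar> < int q" if "\<bar>of_int n * ?h - of_int s / real q\<bar> < 1" for s
    proof -
      have "\<bar>real_of_int (n - s)\<bar> < real q"
        using that assms(2) by (simp add: diff_divide_distrib[symmetric] abs_divide)
      then show ?thesis by linarith
    qed
    consider "\<bar>of_int n * ?h - of_int 0 / real q\<bar> < 1"
      | "\<bar>of_int n * ?h - of_int (int p) / real q\<bar> < 1"
      | "\<bar>of_int n * ?h - of_int (- int p) / real q\<bar> < 1"
      using n by (auto simp: Omega_set_def abs_less_iff)
    then show "n \<in> ?A"
      by cases (use near in \<open>fastforce simp: A_set_def\<close>)+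
  qed
  show "?h * turan_const_int ?A \<le> turan_const_real ?\<Omega>"
  proof (rule turan_const_real_ge[OF \<Omega>(1,2) h A])
    fix n assume "n \<in> ?A"
    (* Integrality turns |n - s| < q into |n - s| <= q - 1, which leaves room for a ball of radius
       1/q. *)
    have near: "\<bar>x - of_int s / real q\<bar> < 1" if "\<bar>n - s\<bar> < int q" "x \<in> ball (of_int n * ?h) ?h" for x s
    proof -
      have "\<bar>real_of_int (n - s)\<bar> \<le> real q - 1" using that(1) by linarith
      then have "\<bar>of_int n / real q - of_int s / real q\<bar> \<le> 1 - 1 / real q"
        using assms(2) by (simp add: diff_divide_distrib[symmetric] abs_divide field_simps)
      moreover have "\<bar>of_int n / real q - x\<bar> < 1 / real q" using that(2) by (simp add: dist_real_def)
      ultimately show ?thesis by linarith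
    qed
    show "ball (of_int n * ?h) ?h \<subseteq> ?\<Omega>"
    proof
      fix x assume x: "x \<in> ball (of_int n * ?h) ?h"
      consider "\<bar>n - 0\<bar> < int q" | "\<bar>n - int p\<bar> < int q" | "\<bar>n - (- int p)\<bar> < int q"
        using \<open>n \<in> ?A\<close> by (auto simp: A_set_def)
      then show "x \<in> ?\<Omega>"
        by cases (use near[OF _ x] in \<open>fastforce simp: Omega_set_def abs_less_iff\<close>)+
    qed
  qed
qed

end
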